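(* Let $G$ be a countable group that admits a topologically free, extremely proximal action $G\curvearrowright X$ by homeomorphisms on a Hausdorff space $X$ with more than two points. Then, if $R$ is a countable domain, the group ring $RG$ is primitive. Moreover, the group ring $KG$ is primitive for any field $K$.
   Context: Let $G$ be a group and let $X$ be a Hausdorff space with $\#X>2$. An action by homeomorphisms $G\curvearrowright X$ is said to be: (1) an extremely proximal action if, for every pair of non-empty open subsets $U,V\subseteq X$, there exists $g\in G$ such that $g(X\setminus U)\subseteq V$; (2) topologically free if, for every $g\in G\setminus\{1\}$, the set of points of $X$ fixed by $g$ is nowhere dense. A ring $S$ is (right) primitive if it has a faithful irreducible (i.e. simple) right $S$-module. "Primitive" means right primitive in this sense. *)

theory Defs
  imports
    "HOL-Analysis.Analysis"
    "HOL-Algebra.Module"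
    "HOL-Algebra.Algebraic_Closure_Type"
    "HOL-Library.Poly_Mapping"
begin

section \<open>Group actions by homeomorphisms\<close>

text \<open>
  Groups are types of class \<open>group_add\<close>: they are written additively, with neutral element
  \<open>0\<close> and inverse \<open>- g\<close>, but are \<^emph>\<open>not\<close> assumed commutative.
\<close>

definition homeo_action :: "('g::group_add \<Rightarrow> 'x::topological_space \<Rightarrow> 'x) \<Rightarrow> bool" where
  "homeo_action act \<longleftrightarrow>
     (\<forall>x. act 0 x = x) \<and>
     (\<forall>g h x. act (g + h) x = act g (act h x)) \<and>
     (\<forall>g. \<exists>f. homeomorphism UNIV UNIV (act g) f)"

definition extremely_proximal :: "('g::group_add \<Rightarrow> 'x::topological_space \<Rightarrow> 'x) \<Rightarrow> bool" where
  "extremely_proximal act \<longleftrightarrow>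
     (\<forall>U V. open U \<and> U \<noteq> {} \<and> open V \<and> V \<noteq> {} \<longrightarrow> (\<exists>g. act g ` (UNIV - U) \<subseteq> V))"

definition nowhere_dense :: "'x::topological_space set \<Rightarrow> bool" where
  "nowhere_dense A \<longleftrightarrow> interior (closure A) = {}"

definition topologically_free :: "('g::group_add \<Rightarrow> 'x::topological_space \<Rightarrow> 'x) \<Rightarrow> bool" where
  "topologically_free act \<longleftrightarrow> (\<forall>g. g \<noteq> 0 \<longrightarrow> nowhere_dense {x. act g x = x})"


section \<open>Right modules and right primitive rings\<close>

text \<open>
  The library locale \<open>module\<close> covers left modules over commutative rings only.  We reuse its record
  type for right modules: \<open>a \<odot>\<^bsub>M\<^esub> x\<close> stands for the right action \<open>x \<cdot> a\<close>,
  so that \<open>smult_assoc\<close> below reads \<open>x \<cdot> (a b) = (x \<cdot> a) \<cdot> b\<close>.  The ring multiplication and unit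
  fields of \<open>M\<close> are irrelevant.
\<close>

locale right_module = R?: ring R + M?: abelian_group M
  for R :: "('s, 'c) ring_scheme" (structure) and M :: "('s, 'm, 'd) module_scheme" (structure) +
  assumes smult_closed [simp, intro]:
      "\<lbrakk>a \<in> carrier R; x \<in> carrier M\<rbrakk> \<Longrightarrow> a \<odot>\<^bsub>M\<^esub> x \<in> carrier M"
    and smult_distr_ring:
      "\<lbrakk>a \<in> carrier R; b \<in> carrier R; x \<in> carrier M\<rbrakk> \<Longrightarrow>
       (a \<oplus> b) \<odot>\<^bsub>M\<^esub> x = a \<odot>\<^bsub>M\<^esub> x \<oplus>\<^bsub>M\<^esub> b \<odot>\<^bsub>M\<^esub> x"
    and smult_distr_module:
      "\<lbrakk>a \<in> carrier R; x \<in> carrier M; y \<in> carrier M\<rbrakk> \<Longrightarrow>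
       a \<odot>\<^bsub>M\<^esub> (x \<oplus>\<^bsub>M\<^esub> y) = a \<odot>\<^bsub>M\<^esub> x \<oplus>\<^bsub>M\<^esub> a \<odot>\<^bsub>M\<^esub> y"
    and smult_assoc:
      "\<lbrakk>a \<in> carrier R; b \<in> carrier R; x \<in> carrier M\<rbrakk> \<Longrightarrow>
       (a \<otimes> b) \<odot>\<^bsub>M\<^esub> x = b \<odot>\<^bsub>M\<^esub> (a \<odot>\<^bsub>M\<^esub> x)"
    and smult_one [simp]:
      "x \<in> carrier M \<Longrightarrow> \<one> \<odot>\<^bsub>M\<^esub> x = x"

definition simple_right_module ::
    "('s, 'c) ring_scheme \<Rightarrow> ('s, 'm, 'd) module_scheme \<Rightarrow> bool" where
  "simple_right_module R M \<longleftrightarrow>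
     right_module R M \<and> carrier M \<noteq> {\<zero>\<^bsub>M\<^esub>} \<and>
     (\<forall>N. submodule N R M \<longrightarrow> N = {\<zero>\<^bsub>M\<^esub>} \<or> N = carrier M)"

definition faithful_right_module ::
    "('s, 'c) ring_scheme \<Rightarrow> ('s, 'm, 'd) module_scheme \<Rightarrow> bool" where
  "faithful_right_module R M \<longleftrightarrow>
     right_module R M \<and>
     (\<forall>a\<in>carrier R. (\<forall>x\<in>carrier M. a \<odot>\<^bsub>M\<^esub> x = \<zero>\<^bsub>M\<^esub>) \<longrightarrow> a = \<zero>\<^bsub>R\<^esub>)"

text \<open>
  HOL cannot quantify over types inside a formula, so the type of the module elements has to be
  fixed.  Subsets of the ring suffice, because a simple module is isomorphic to a quotient of the
  ring, whose elements are cosets; lemma \<open>right_primitiveI\<close> shows that nothing is lost.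
\<close>

definition right_primitive :: "('s, 'c) ring_scheme \<Rightarrow> bool" where
  "right_primitive R \<longleftrightarrow>
     (\<exists>M :: ('s, 's set) module. simple_right_module R M \<and> faithful_right_module R M)"

lemma simple_right_module_cyclic:
  assumes S: "simple_right_module R M" and m: "m \<in> carrier M" "m \<noteq> \<zero>\<^bsub>M\<^esub>"
  shows "(\<lambda>a. a \<odot>\<^bsub>M\<^esub> m) ` carrier R = carrier M"
proof -
  interpret right_module R M
    using S by (simp add: simple_right_module_def)
  let ?N = "(\<lambda>a. a \<odot>\<^bsub>M\<^esub> m) ` carrier R"
  have zero: "\<zero>\<^bsub>R\<^esub> \<odot>\<^bsub>M\<^esub> m = \<zero>\<^bsub>M\<^esub>"
    using smult_distr_ring[of "\<zero>\<^bsub>R\<^esub>" "\<zero>\<^bsub>R\<^esub>" m] m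
      M.add.l_cancel_one'[of "\<zero>\<^bsub>R\<^esub> \<odot>\<^bsub>M\<^esub> m" "\<zero>\<^bsub>R\<^esub> \<odot>\<^bsub>M\<^esub> m"] by simp
  have neg: "\<ominus>\<^bsub>M\<^esub> (a \<odot>\<^bsub>M\<^esub> m) = (\<ominus>\<^bsub>R\<^esub> a) \<odot>\<^bsub>M\<^esub> m" if "a \<in> carrier R" for a
    using that m zero smult_distr_ring[of "\<ominus>\<^bsub>R\<^esub> a" a m]
    by (intro M.minus_equality) (auto simp: R.l_neg)
  have "submodule ?N R M"
  proof (intro submodule.intro subgroup.intro submodule_axioms.intro, goal_cases)
    case 1 then show ?case using m by auto
  next
    case (2 x y) then show ?case using m by (auto simp: smult_distr_ring[symmetric])
  next
    case 3 then show ?case using zero by force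
  next
    case (4 x) then show ?case using neg by (auto simp flip: a_inv_def)
  next
    case (5 a x) then show ?case using m by (auto simp: smult_assoc[symmetric])
  qed
  moreover have "m \<in> ?N"
    using m by (auto intro!: image_eqI[of _ _ "\<one>\<^bsub>R\<^esub>"])
  ultimately show ?thesis
    using S m by (auto simp: simple_right_module_def)
qed

lemma right_primitiveI:
  fixes R :: "('s, 'c) ring_scheme" and M :: "('s, 'm, 'd) module_scheme"
  assumes S: "simple_right_module R M" and F: "faithful_right_module R M"
  shows "right_primitive R"
proof -
  interpret right_module R M
    using S by (simp add: simple_right_module_def)
  obtain m where m: "m \<in> carrier M" "m \<noteq> \<zero>\<^bsub>M\<^esub>"
    using S M.zero_closed unfolding simple_right_module_def by blast
  note cyc = simple_right_module_cyclic[OF S m]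
  define f where "f x = {a \<in> carrier R. a \<odot>\<^bsub>M\<^esub> m = x}" for x
  have inj: "inj_on f (carrier M)"
  proof (rule inj_onI)
    fix x y assume xy: "x \<in> carrier M" "y \<in> carrier M" "f x = f y"
    then obtain a where "a \<in> carrier R" "x = a \<odot>\<^bsub>M\<^esub> m"
      using cyc by (metis imageE)
    then have "a \<in> f x" by (simp add: f_def)
    then have "a \<in> f y" using xy by simp
    then show "x = y" using \<open>x = a \<odot>\<^bsub>M\<^esub> m\<close> by (simp add: f_def)
  qed
  then have f_eq [simp]: "f x = f y \<longleftrightarrow> x = y" if "x \<in> carrier M" "y \<in> carrier M" for x y
    using that by (simp add: inj_on_eq_iff)
  define k where "k = the_inv_into (carrier M) f"
  have kf [simp]: "k (f x) = x" if "x \<in> carrier M" for x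
    using the_inv_into_f_f[OF inj that] by (simp add: k_def)
  define M' :: "('s, 's set) module" where
    "M' = \<lparr>carrier = f ` carrier M, monoid.mult = (\<lambda>x y. x), one = {}, ring.zero = f \<zero>\<^bsub>M\<^esub>,
           add = (\<lambda>x y. f (k x \<oplus>\<^bsub>M\<^esub> k y)), smult = (\<lambda>a x. f (a \<odot>\<^bsub>M\<^esub> k x))\<rparr>"
  have sel [simp]: "carrier M' = f ` carrier M" "\<zero>\<^bsub>M'\<^esub> = f \<zero>\<^bsub>M\<^esub>"
    "p \<oplus>\<^bsub>M'\<^esub> q = f (k p \<oplus>\<^bsub>M\<^esub> k q)" "a \<odot>\<^bsub>M'\<^esub> p = f (a \<odot>\<^bsub>M\<^esub> k p)" for p q a
    by (simp_all add: M'_def)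
  have "abelian_group M'"
  proof (rule abelian_groupI)
    fix p assume "p \<in> carrier M'"
    then obtain x where "x \<in> carrier M" "p = f x" by auto
    then show "\<exists>q\<in>carrier M'. q \<oplus>\<^bsub>M'\<^esub> p = \<zero>\<^bsub>M'\<^esub>"
      by (intro bexI[of _ "f (\<ominus>\<^bsub>M\<^esub> x)"]) (auto simp: M.l_neg)
  qed (auto simp: M.a_ac)
  then have RM: "right_module R M'"
    by (intro right_module.intro right_module_axioms.intro R.ring_axioms)
       (auto simp: smult_distr_ring smult_distr_module smult_assoc)
  have "N = {\<zero>\<^bsub>M'\<^esub>} \<or> N = carrier M'" if N: "submodule N R M'" for N
  proof -
    interpret M': right_module R M' by fact
    interpret N: submodule N R M' by fact
    have sub: "N \<subseteq> f ` carrier M" using N.subset by simp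
    have inv': "f (\<ominus>\<^bsub>M\<^esub> x) \<in> N" if x: "x \<in> carrier M" "f x \<in> N" for x
    proof -
      have "\<ominus>\<^bsub>M'\<^esub> f x \<in> N"
        using N.m_inv_closed[OF x(2)] by (simp add: a_inv_def)
      moreover have "\<ominus>\<^bsub>M'\<^esub> f x = f (\<ominus>\<^bsub>M\<^esub> x)"
        by (rule M'.M.minus_equality) (use x in \<open>auto simp: M.l_neg\<close>)
      ultimately show ?thesis by simp
    qed
    have mem: "k p \<in> carrier M" "f (k p) = p" if "p \<in> N" for p
      using that sub by auto
    have kN: "x \<in> k ` N" if "x \<in> carrier M" "f x \<in> N" for x
      using that by (metis imageI kf)
    have "submodule (k ` N) R M"
    proof (intro submodule.intro subgroup.intro submodule_axioms.intro, goal_cases)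
      case 1 then show ?case using mem by auto
    next
      case (2 x y)
      then obtain p q where pq: "p \<in> N" "q \<in> N" "x = k p" "y = k q" by auto
      then have "f (x \<oplus>\<^bsub>M\<^esub> y) \<in> N" using N.m_closed[of p q] by simp
      then show ?case using pq mem kN by simp
    next
      case 3
      have "f \<zero>\<^bsub>M\<^esub> \<in> N" using N.one_closed by simp
      then show ?case using kN by simp
    next
      case (4 x)
      then obtain p where p: "p \<in> N" "x = k p" by auto
      then have "f (\<ominus>\<^bsub>M\<^esub> x) \<in> N" using inv'[of x] mem by simp
      then have "\<ominus>\<^bsub>M\<^esub> x \<in> k ` N"
        using p mem kN by simp
      then show ?case by (simp add: a_inv_def)
    next
      case (5 a x)
      then obtain p where p: "p \<in> N" "x = k p" by auto
      then have "f (a \<odot>\<^bsub>M\<^esub> x) \<in> N" using N.smult_closed[of a p] 5 by simp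
      then show ?case using p 5 mem kN by simp
    qed
    then have "k ` N = {\<zero>\<^bsub>M\<^esub>} \<or> k ` N = carrier M"
      using S by (auto simp: simple_right_module_def)
    moreover have "N = f ` k ` N"
      using mem by (simp add: image_image)
    ultimately show ?thesis by (elim disjE) auto
  qed
  moreover have "carrier M' \<noteq> {\<zero>\<^bsub>M'\<^esub>}"
    using m by (metis M.zero_closed f_eq imageI sel(1) singletonD)
  ultimately have "simple_right_module R M'"
    using RM by (auto simp: simple_right_module_def)
  moreover have "faithful_right_module R M'"
    unfolding faithful_right_module_def
  proof (intro conjI ballI impI RM)
    fix a assume a: "a \<in> carrier R" "\<forall>p\<in>carrier M'. a \<odot>\<^bsub>M'\<^esub> p = \<zero>\<^bsub>M'\<^esub>"
    have "a \<odot>\<^bsub>M\<^esub> x = \<zero>\<^bsub>M\<^esub>" if "x \<in> carrier M" for x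
      using a that by simp
    then show "a = \<zero>\<^bsub>R\<^esub>" using F a by (auto simp: faithful_right_module_def)
  qed
  ultimately show ?thesis unfolding right_primitive_def by blast
qed


section \<open>Group rings\<close>

text \<open>
  The type \<open>'g \<Rightarrow>\<^sub>0 'r\<close> of finitely supported functions is the group ring of \<open>'g\<close> over \<open>'r\<close>, its
  multiplication being convolution (determined by \<open>group_ring_mult_single\<close>).
\<close>

abbreviation group_ring :: "('g::group_add \<Rightarrow>\<^sub>0 'r::ring_1) ring" where
  "group_ring \<equiv> ring_of_type_algebra"

lemma group_ring_mult_single:
  fixes g h :: "'g::group_add" and a b :: "'r::ring_1"
  shows "Poly_Mapping.single g a \<otimes>\<^bsub>group_ring\<^esub> Poly_Mapping.single h b
         = Poly_Mapping.single (g + h) (a * b)"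
  by (simp add: ring_of_type_algebra_def mult_single)

lemma ring_group_ring: "ring (group_ring :: ('g::group_add \<Rightarrow>\<^sub>0 'r::ring_1) ring)"
proof (rule ringI)
  show "abelian_group (group_ring :: ('g \<Rightarrow>\<^sub>0 'r) ring)"
  proof (rule abelian_groupI)
    show "\<exists>y\<in>carrier group_ring. y \<oplus>\<^bsub>group_ring\<^esub> x = \<zero>\<^bsub>group_ring\<^esub>" for x :: "'g \<Rightarrow>\<^sub>0 'r"
      by (intro bexI[of _ "- x"]) (auto simp: ring_of_type_algebra_def)
  qed (auto simp: ring_of_type_algebra_def algebra_simps)
  show "monoid (group_ring :: ('g \<Rightarrow>\<^sub>0 'r) ring)"
    by (rule monoidI) (auto simp: ring_of_type_algebra_def algebra_simps)
qed (auto simp: ring_of_type_algebra_def algebra_simps)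

end

theory Submission
  imports Defs
begin

text \<open>
  It suffices to find a proper right ideal \<open>J\<close> of the group ring that is comaximal with every nonzero
  two-sided ideal: a maximal right ideal above \<open>J\<close> then contains no nonzero two-sided ideal, and the
  quotient by it is a faithful simple module.

  Let \<open>a\<^sub>0, a\<^sub>1, \<dots>\<close> be countably many elements that meet all nonzero two-sided ideals, and let \<open>J\<close> be
  generated by the elements \<open>b\<^sub>n = u\<^sub>n + g\<^sub>n a\<^sub>n h\<^sub>n\<close> with group elements \<open>u\<^sub>n, g\<^sub>n, h\<^sub>n\<close>; comaximality
  holds because \<open>u\<^sub>n\<close> is a unit.  Choose pairwise disjoint open sets \<open>D\<^sub>i\<close>.  Extreme proximality and
  topological freeness provide \<open>u\<^sub>n, g\<^sub>n, h\<^sub>n\<close> such that the group elements in the support of the \<open>b\<^sub>n\<close> map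
  the complement of some \<open>D\<^sub>i\<close> into some \<open>D\<^sub>j\<close>, with pairwise disjoint images.  A ping-pong argument
  shows that a sum \<open>\<Sum> b\<^sub>n r\<^sub>n\<close> is zero or has at least two elements in its support, so that \<open>1 \<notin> J\<close>.

  Over a countable domain the \<open>a\<^sub>n\<close> may be all nonzero elements.  Over an arbitrary field, the nonzero
  elements with coefficients in the image of the integers meet every nonzero two-sided ideal.
\<close>

section \<open>Right ideals and primitivity\<close>

definition is_right_ideal :: "'s::ring_1 set \<Rightarrow> bool" where
  "is_right_ideal J \<longleftrightarrow> 0 \<in> J \<and> (\<forall>x\<in>J. \<forall>y\<in>J. x + y \<in> J) \<and> (\<forall>x\<in>J. \<forall>s. x * s \<in> J)"

lemma is_right_idealD:
  assumes "is_right_ideal J"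
  shows "0 \<in> J" "x \<in> J \<Longrightarrow> y \<in> J \<Longrightarrow> x + y \<in> J" "x \<in> J \<Longrightarrow> x * s \<in> J"
    "x \<in> J \<Longrightarrow> - x \<in> J" "x \<in> J \<Longrightarrow> y \<in> J \<Longrightarrow> x - y \<in> J"
proof -
  show *: "0 \<in> J" "x \<in> J \<Longrightarrow> y \<in> J \<Longrightarrow> x + y \<in> J" "x \<in> J \<Longrightarrow> x * s \<in> J" for x y s
    using assms by (auto simp: is_right_ideal_def)
  show **: "x \<in> J \<Longrightarrow> - x \<in> J" for x
    using *(3)[of x "-1"] by simp
  show "x \<in> J \<Longrightarrow> y \<in> J \<Longrightarrow> x - y \<in> J"
    using *(2)[of x "- y"] **[of y] by simp
qed

text \<open>Zorn's lemma on the right ideals above \<open>J\<close> that avoid \<open>1\<close>; for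
  a right ideal this is properness, and it passes to unions of chains.\<close>

lemma right_ideal_extends_to_maximal:
  fixes J :: "'s::ring_1 set"
  assumes "is_right_ideal J" "1 \<notin> J"
  obtains M where "is_right_ideal M" "J \<subseteq> M" "1 \<notin> M"
    "\<And>N. is_right_ideal N \<Longrightarrow> M \<subseteq> N \<Longrightarrow> N = M \<or> N = UNIV"
proof -
  define \<F> where "\<F> = {N. is_right_ideal N \<and> J \<subseteq> N \<and> 1 \<notin> N}"
  have "\<exists>M\<in>\<F>. \<forall>Y\<in>\<F>. M \<subseteq> Y \<longrightarrow> Y = M"
  proof (rule subset_Zorn_nonempty)
    show "\<F> \<noteq> {}" using assms by (auto simp: \<F>_def)
    fix C assume C: "C \<noteq> {}" "subset.chain \<F> C"
    then have sub: "C \<subseteq> \<F>" and lin: "\<And>P Q. P \<in> C \<Longrightarrow> Q \<in> C \<Longrightarrow> P \<subseteq> Q \<or> Q \<subseteq> P"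
      by (auto simp: subset_chain_def)
    have "x + y \<in> \<Union>C" if "x \<in> \<Union>C" "y \<in> \<Union>C" for x y
    proof -
      obtain P Q where PQ: "P \<in> C" "Q \<in> C" "x \<in> P" "y \<in> Q" using \<open>x \<in> \<Union>C\<close> \<open>y \<in> \<Union>C\<close> by blast
      then obtain T where "T \<in> C" "x \<in> T" "y \<in> T" using lin[of P Q] by blast
      then have "x + y \<in> T" using sub by (auto simp: \<F>_def is_right_ideal_def)
      then show ?thesis using \<open>T \<in> C\<close> by blast
    qed
    moreover have "x * s \<in> \<Union>C" if "x \<in> \<Union>C" for x s
      using that sub unfolding \<F>_def is_right_ideal_def by blast
    moreover have "0 \<in> \<Union>C" "J \<subseteq> \<Union>C" "1 \<notin> \<Union>C"
      using C sub by (auto simp: \<F>_def is_right_ideal_def)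
    ultimately show "\<Union>C \<in> \<F>"
      by (simp add: \<F>_def is_right_ideal_def)
  qed
  then obtain M where M: "M \<in> \<F>" and max: "\<And>N. N \<in> \<F> \<Longrightarrow> M \<subseteq> N \<Longrightarrow> N = M" by blast
  show thesis
  proof
    show "is_right_ideal M" "J \<subseteq> M" "1 \<notin> M" using M by (auto simp: \<F>_def)
    fix N assume N: "is_right_ideal N" "M \<subseteq> N"
    show "N = M \<or> N = UNIV"
    proof (cases "1 \<in> N")
      case True
      then have "x \<in> N" for x using is_right_idealD(3)[OF N(1), of 1 x] by simp
      then show ?thesis by auto
    next
      case False
      then show ?thesis using N M max[of N] by (auto simp: \<F>_def)
    qed
  qed
qed

lemma ring_ring_of_type_algebra: "ring (ring_of_type_algebra :: 's::ring_1 ring)"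
proof -
  have "\<exists>y. y + x = 0" for x :: 's
    by (intro exI[of _ "- x"]) simp
  then show ?thesis
    by (intro ringI abelian_groupI monoidI) (auto simp: ring_of_type_algebra_def algebra_simps)
qed

text \<open>
  The module \<open>S/M\<close> is realised on a system of representatives \<open>k\<close> of the cosets of \<open>M\<close>.
\<close>

lemma right_primitive_if_maximal_right_ideal:
  fixes M :: "'s::ring_1 set"
  assumes M: "is_right_ideal M" "1 \<notin> M"
    and max: "\<And>N. is_right_ideal N \<Longrightarrow> M \<subseteq> N \<Longrightarrow> N = M \<or> N = UNIV"
    and core: "\<And>a. (\<And>x. x * a \<in> M) \<Longrightarrow> a = 0"
  shows "right_primitive (ring_of_type_algebra :: 's ring)"
proof -
  note RI = is_right_idealD[OF M(1)]
  define k where "k x = (SOME y. y - x \<in> M)" for x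
  have k_mem: "k x - x \<in> M" for x
    unfolding k_def by (rule someI[of _ x]) (simp add: RI)
  have k_eq: "k x = k y \<longleftrightarrow> x - y \<in> M" for x y
  proof
    assume "k x = k y"
    then show "x - y \<in> M" using RI(5)[OF k_mem[of y] k_mem[of x]] by simp
  next
    \<comment> \<open>The two predicates under \<open>SOME\<close> coincide when
      \<open>x - y\<close> lies in \<open>M\<close>, so both choices are the same element.\<close>
    assume d: "x - y \<in> M"
    have "z - x \<in> M \<longleftrightarrow> z - y \<in> M" for z
      using RI(2)[of "z - x" "x - y"] RI(5)[of "z - y" "x - y"] d by auto
    then show "k x = k y" by (simp add: k_def)
  qed
  have kk [simp]: "k (k x) = k x" for x
    by (simp add: k_eq k_mem)
  have k_add [simp]: "k (k x + y) = k (x + y)" "k (y + k x) = k (y + x)" for x y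
    by (auto simp: k_eq k_mem)
  have k_mult [simp]: "k (k x * s) = k (x * s)" for x s
    using RI(3)[OF k_mem[of x], of s] by (simp add: k_eq algebra_simps)
  have k0: "k x = k 0 \<longleftrightarrow> x \<in> M" for x
    by (simp add: k_eq)
  let ?R = "ring_of_type_algebra :: 's ring"
  define Q :: "('s, 's) module" where
    "Q = \<lparr>carrier = range k, monoid.mult = (\<lambda>x y. x), one = 0, ring.zero = k 0,
           add = (\<lambda>x y. k (x + y)), smult = (\<lambda>a x. k (x * a))\<rparr>"
  have sel [simp]: "carrier Q = range k" "\<zero>\<^bsub>Q\<^esub> = k 0" "x \<oplus>\<^bsub>Q\<^esub> y = k (x + y)"
    "a \<odot>\<^bsub>Q\<^esub> x = k (x * a)" for x y a
    by (simp_all add: Q_def)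
  have "abelian_group Q"
  proof (rule abelian_groupI)
    fix p assume "p \<in> carrier Q"
    then obtain x where "p = k x" by auto
    then show "\<exists>q\<in>carrier Q. q \<oplus>\<^bsub>Q\<^esub> p = \<zero>\<^bsub>Q\<^esub>"
      by (intro bexI[of _ "k (- x)"]) auto
  qed (auto simp: algebra_simps)
  moreover have "right_module_axioms ?R Q"
    by (rule right_module_axioms.intro) (auto simp: ring_of_type_algebra_def algebra_simps)
  ultimately have RQ: "right_module ?R Q"
    by (simp add: right_module.intro ring_ring_of_type_algebra)
  have "N = {\<zero>\<^bsub>Q\<^esub>} \<or> N = carrier Q" if "submodule N ?R Q" for N
  proof -
    interpret N: submodule N ?R Q by fact
    have N_add: "k (x + y) \<in> N" if "k x \<in> N" "k y \<in> N" for x y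
      using N.m_closed[OF that] by simp
    have N_mult: "k (x * s) \<in> N" if "k x \<in> N" for x s
      using N.smult_closed[OF _ that, of s] by (simp add: ring_of_type_algebra_def)
    have N_zero: "k 0 \<in> N" using N.one_closed by simp
    have N_sub: "N \<subseteq> range k" using N.subset by simp
    \<comment> \<open>Submodules of \<open>Q\<close> pull back along \<open>k\<close> to right
      ideals above \<open>M\<close>, where maximality applies.\<close>
    have "is_right_ideal {x. k x \<in> N}"
      using N_add N_mult N_zero by (simp add: is_right_ideal_def)
    moreover have "M \<subseteq> {x. k x \<in> N}"
    proof
      fix x assume "x \<in> M"
      then have "k x = k 0" by (simp add: k0)
      then show "x \<in> {x. k x \<in> N}" using N_zero by simp
    qed
    ultimately consider "{x. k x \<in> N} = M" | "{x. k x \<in> N} = UNIV" using max by metis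
    then show ?thesis
    proof cases
      case 1
      then have "y \<in> M" if "k y \<in> N" for y using that by blast
      then have "N = {k 0}" using N_zero N_sub k0 by blast
      then show ?thesis by simp
    next
      case 2
      then show ?thesis using N_sub by auto
    qed
  qed
  moreover have "k 1 \<noteq> k 0" using M by (simp add: k0)
  then have "carrier Q \<noteq> {\<zero>\<^bsub>Q\<^esub>}" by auto
  ultimately have "simple_right_module ?R Q"
    using RQ by (auto simp: simple_right_module_def)
  moreover have "faithful_right_module ?R Q"
    unfolding faithful_right_module_def
  proof (intro conjI ballI impI RQ)
    fix a :: 's assume "\<forall>x\<in>carrier Q. a \<odot>\<^bsub>Q\<^esub> x = \<zero>\<^bsub>Q\<^esub>"
    then have "k (k x * a) = k 0" for x by simp
    then have "x * a \<in> M" for x by (simp flip: k0)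
    then show "a = \<zero>\<^bsub>?R\<^esub>" using core by (simp add: ring_of_type_algebra_def)
  qed
  ultimately show ?thesis by (rule right_primitiveI)
qed

lemma right_primitive_if_comaximal:
  fixes J :: "'s::ring_1 set"
  assumes J: "is_right_ideal J" "1 \<notin> J"
    and comax: "\<And>I. is_right_ideal I \<Longrightarrow> (\<And>s x. x \<in> I \<Longrightarrow> s * x \<in> I) \<Longrightarrow> I \<noteq> {0} \<Longrightarrow>
      \<exists>x\<in>I. \<exists>y\<in>J. x + y = 1"
  shows "right_primitive (ring_of_type_algebra :: 's ring)"
proof -
  obtain M where M: "is_right_ideal M" "J \<subseteq> M" "1 \<notin> M"
    and max: "\<And>N. is_right_ideal N \<Longrightarrow> M \<subseteq> N \<Longrightarrow> N = M \<or> N = UNIV"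
    using right_ideal_extends_to_maximal[OF J] by metis
  note RI = is_right_idealD[OF M(1)]
  \<comment> \<open>The largest two-sided ideal inside \<open>M\<close>. Were it nonzero,
    comaximality with \<open>J\<close> would write \<open>1\<close> as a sum of two elements of
    \<open>M\<close>.\<close>
  let ?I = "{a. \<forall>x. x * a \<in> M}"
  have "is_right_ideal ?I"
    by (auto simp: is_right_ideal_def RI distrib_left simp flip: mult.assoc)
  moreover have "s * x \<in> ?I" if "x \<in> ?I" for s x
    using that by (simp flip: mult.assoc)
  moreover have False if "x \<in> ?I" "y \<in> J" "x + y = 1" for x y
  proof -
    have "1 * x \<in> M" "y \<in> M" using that M by blast+
    then show False using RI(2)[of x y] M \<open>x + y = 1\<close> by simp
  qed
  ultimately have "?I = {0}" using comax[of ?I] by blast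
  then show ?thesis
    using right_primitive_if_maximal_right_ideal[OF M(1,3) max] by blast
qed


section \<open>Topologically free extremely proximal actions\<close>

locale free_extremely_proximal_action =
  fixes act :: "'g::group_add \<Rightarrow> 'x::t2_space \<Rightarrow> 'x"
  assumes three_points: "\<exists>x y z :: 'x. x \<noteq> y \<and> y \<noteq> z \<and> x \<noteq> z"
    and homeo: "homeo_action act"
    and free: "topologically_free act"
    and proximal: "extremely_proximal act"
begin

lemma act_zero [simp]: "act 0 x = x"
  and act_add [simp]: "act (g + h) x = act g (act h x)"
  using homeo by (auto simp: homeo_action_def)

lemma act_minus_act [simp]: "act (- g) (act g x) = x" "act g (act (- g) x) = x"
  using act_add[of "- g" g x] act_add[of g "- g" x] by simp_all

lemma act_eq_iff [simp]: "act g x = act g y \<longleftrightarrow> x = y"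
  by (metis act_minus_act(1))

lemma continuous_act: "continuous_on UNIV (act g)"
  using homeo by (auto simp: homeo_action_def homeomorphism_def)

lemma open_vimage_act: "open U \<Longrightarrow> open (act g -` U)"
  using continuous_act by (simp add: continuous_on_open_vimage)

lemma open_image_act: "open U \<Longrightarrow> open (act g ` U)"
proof -
  have "act g ` U = act (- g) -` U"
    by (auto simp: image_iff) (metis act_minus_act(2))
  then show "open U \<Longrightarrow> open (act g ` U)" by (simp add: open_vimage_act)
qed

lemma proximalE:
  assumes "open U" "U \<noteq> {}" "open V" "V \<noteq> {}"
  obtains g where "\<And>x. x \<notin> U \<Longrightarrow> act g x \<in> V"
proof -
  obtain g where "act g ` (UNIV - U) \<subseteq> V"
    using proximal assms unfolding extremely_proximal_def by metis
  then show thesis by (intro that[of g]) blast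
qed

text \<open>An isolated point \<open>x\<close> would yield a \<open>g\<close> sending all other
  points to \<open>x\<close>; there are at least two of them, and \<open>g\<close> acts
  injectively.\<close>

lemma not_open_singleton: "\<not> open {x :: 'x}"
proof
  assume "open {x}"
  then obtain g where g: "\<And>y. y \<notin> {x} \<Longrightarrow> act g y \<in> {x}"
    using proximalE[of "{x}" "{x}"] by blast
  obtain y z where "y \<noteq> x" "z \<noteq> x" "y \<noteq> z"
    using three_points by metis
  then show False using g[of y] g[of z] act_eq_iff[of g y z] by simp
qed

lemma open_contains_disjoint_opens:
  assumes "open (V :: 'x set)" "V \<noteq> {}"
  obtains P Q where "open P" "open Q" "P \<noteq> {}" "Q \<noteq> {}" "P \<subseteq> V" "Q \<subseteq> V" "P \<inter> Q = {}"
proof -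
  obtain x where x: "x \<in> V" using assms by blast
  then have "V \<noteq> {x}" using assms not_open_singleton[of x] by blast
  then obtain y where y: "y \<in> V" "x \<noteq> y" using x by blast
  obtain P Q where "open P" "open Q" "x \<in> P" "y \<in> Q" "P \<inter> Q = {}"
    using hausdorff[OF y(2)] by blast
  then show thesis
    using that[of "P \<inter> V" "Q \<inter> V"] x y assms by blast
qed

text \<open>Repeated splitting: of two disjoint open sets the first joins the family and the second
  is split again. Later members lie inside the second and so miss the first.\<close>

lemma disjoint_open_family:
  obtains D :: "nat \<Rightarrow> 'x set"
  where "\<And>n. open (D n)" "\<And>n. D n \<noteq> {}" "\<And>m n. m \<noteq> n \<Longrightarrow> D m \<inter> D n = {}"
proof -
  let ?P = "\<lambda>p :: 'x set \<times> 'x set. open (fst p) \<and> open (snd p) \<and> fst p \<noteq> {} \<and> snd p \<noteq> {}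
    \<and> fst p \<inter> snd p = {}"
  have "\<exists>f. \<forall>n. ?P (f n) \<and> fst (f (Suc n)) \<union> snd (f (Suc n)) \<subseteq> snd (f n)"
  proof (rule dependent_nat_choice)
    show "\<exists>p. ?P p"
      using open_contains_disjoint_opens[of UNIV] by (metis UNIV_not_empty fst_conv open_UNIV snd_conv)
    fix p assume "?P p"
    then obtain P Q where "open P" "open Q" "P \<noteq> {}" "Q \<noteq> {}" "P \<subseteq> snd p" "Q \<subseteq> snd p" "P \<inter> Q = {}"
      using open_contains_disjoint_opens[of "snd p"] by metis
    then show "\<exists>q. ?P q \<and> fst q \<union> snd q \<subseteq> snd p"
      by (intro exI[of _ "(P, Q)"]) simp
  qed
  then obtain f where "\<forall>n. ?P (f n) \<and> fst (f (Suc n)) \<union> snd (f (Suc n)) \<subseteq> snd (f n)" ..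
  then have f: "?P (f n)" "fst (f (Suc n)) \<union> snd (f (Suc n)) \<subseteq> snd (f n)" for n
    by simp_all
  have anti: "snd (f n) \<subseteq> snd (f m)" if "m \<le> n" for m n
    using lift_Suc_antimono_le[of "\<lambda>n. snd (f n)", OF _ that] f(2) by blast
  have disj: "fst (f m) \<inter> fst (f n) = {}" if "m < n" for m n
  proof -
    have "fst (f (Suc (n - 1))) \<subseteq> snd (f m)"
      using that f(2)[of "n - 1"] anti[of m "n - 1"] by fastforce
    then have "fst (f n) \<subseteq> snd (f m)" using that by simp
    then show ?thesis using f(1)[of m] by blast
  qed
  show thesis
  proof
    show "open (fst (f n))" "fst (f n) \<noteq> {}" for n using f(1) by blast+
    show "fst (f m) \<inter> fst (f n) = {}" if "m \<noteq> n" for m n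
      using disj[of m n] disj[of n m] that by (cases "m < n") auto
  qed
qed

text \<open>Shrink \<open>B\<close> for one group element at a time. The fixed points of
  \<open>g\<close> are nowhere dense, so \<open>g\<close> moves some point of \<open>B\<close>;
  separating it from its image gives a smaller open set that \<open>g\<close> moves off itself.
  Subsets keep what was achieved for earlier elements.\<close>

lemma moved_off_itself:
  assumes "finite F" "0 \<notin> F" "open V" "V \<noteq> {}"
  shows "\<exists>B. open B \<and> B \<noteq> {} \<and> B \<subseteq> V \<and> (\<forall>g\<in>F. \<forall>x\<in>B. act g x \<notin> B)"
  using assms
proof (induction F rule: finite_induct)
  case empty
  then show ?case by blast
next
  case (insert g F)
  then obtain B where B: "open B" "B \<noteq> {}" "B \<subseteq> V" "\<forall>h\<in>F. \<forall>x\<in>B. act h x \<notin> B" by auto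
  have "nowhere_dense {x. act g x = x}"
    using free insert.prems by (auto simp: topologically_free_def)
  then have "\<not> B \<subseteq> closure {x. act g x = x}"
    using B by (metis interior_maximal nowhere_dense_def subset_empty)
  then obtain x where x: "x \<in> B" "act g x \<noteq> x"
    using closure_subset[of "{x. act g x = x}"] by blast
  then obtain P Q where PQ: "open P" "open Q" "act g x \<in> P" "x \<in> Q" "P \<inter> Q = {}"
    using hausdorff[OF x(2)] by blast
  define C where "C = B \<inter> Q \<inter> act g -` P"
  have "open C" "x \<in> C" "C \<subseteq> B"
    using B PQ x by (simp_all add: C_def open_vimage_act open_Int le_infI1)
  moreover have "\<forall>y\<in>C. act g y \<notin> C"
    using PQ by (auto simp: C_def)
  ultimately show ?case using B by (intro exI[of _ C]) blast
qed

text \<open>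
  Off \<open>U\<close>, the translates of \<open>T\<close> by \<open>g\<close> and \<open>h\<close> play ping-pong into \<open>V\<close>: \<open>h\<close> contracts the
  complement of \<open>U\<close> into a set whose \<open>T\<close>-translates are disjoint, and \<open>g\<close> contracts these into \<open>V\<close>.
\<close>

lemma ping_pong_translates:
  assumes "finite T" "T \<noteq> {}" and U: "open U" "U \<noteq> {}" and V: "open V" "V \<noteq> {}"
  obtains g h where "\<And>t x. t \<in> T \<Longrightarrow> x \<notin> U \<Longrightarrow> act (g + t + h) x \<in> V"
    "\<And>t t' x y. t \<in> T \<Longrightarrow> t' \<in> T \<Longrightarrow> x \<notin> U \<Longrightarrow> y \<notin> U \<Longrightarrow>
      act (g + t + h) x = act (g + t' + h) y \<Longrightarrow> t = t'"
proof -
  \<comment> \<open>Moving \<open>B\<close> off itself by the quotients of distinct elements of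
    \<open>T\<close> makes the \<open>T\<close>-translates of \<open>B\<close> pairwise
    disjoint.\<close>
  define F where "F = (\<lambda>(t, t'). - t' + t) ` (T \<times> T) - {0}"
  have "finite F" "0 \<notin> F" using assms by (auto simp: F_def)
  then obtain B where B: "open B" "B \<noteq> {}" "\<And>g x. g \<in> F \<Longrightarrow> x \<in> B \<Longrightarrow> act g x \<notin> B"
    using moved_off_itself[of F UNIV] by auto
  have B_disj: "t = t'" if "t \<in> T" "t' \<in> T" "x \<in> B" "y \<in> B" "act t x = act t' y" for t t' x y
  proof (rule ccontr)
    assume "t \<noteq> t'"
    then have "- t' + t \<noteq> 0" by (metis add.right_neutral add_minus_cancel)
    then have "- t' + t \<in> F" using that by (auto simp: F_def)
    moreover have "act (- t' + t) x = y" using that by simp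
    ultimately show False using B(3)[of "- t' + t" x] that by simp
  qed
  \<comment> \<open>\<open>h\<close> will contract into \<open>P\<close>. The translate of
    \<open>Q\<close> by \<open>s\<close> misses every \<open>T\<close>-translate of
    \<open>P\<close>, so contracting its complement into \<open>V\<close> handles them all at
    once.\<close>
  obtain P Q where PQ: "open P" "open Q" "P \<noteq> {}" "Q \<noteq> {}" "P \<subseteq> B" "Q \<subseteq> B" "P \<inter> Q = {}"
    using open_contains_disjoint_opens[OF B(1,2)] by blast
  obtain s where s: "s \<in> T" using assms by blast
  have off: "act t x \<notin> act s ` Q" if "t \<in> T" "x \<in> P" for t x
  proof
    assume "act t x \<in> act s ` Q"
    then obtain y where y: "y \<in> Q" "act t x = act s y" by blast
    then have "t = s" using B_disj[of t s x y] that s PQ by blast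
    then show False using y that PQ by auto
  qed
  obtain h where h: "\<And>x. x \<notin> U \<Longrightarrow> act h x \<in> P"
    using proximalE[OF U PQ(1,3)] by blast
  obtain g where g: "\<And>x. x \<notin> act s ` Q \<Longrightarrow> act g x \<in> V"
    using proximalE[of "act s ` Q" V] PQ V open_image_act by blast
  show thesis
  proof
    show "act (g + t + h) x \<in> V" if "t \<in> T" "x \<notin> U" for t x
      using g off[OF that(1) h[OF that(2)]] by simp
    show "t = t'" if "t \<in> T" "t' \<in> T" "x \<notin> U" "y \<notin> U"
      "act (g + t + h) x = act (g + t' + h) y" for t t' x y
      using that B_disj[of t t' "act h x" "act h y"] h PQ(5) by auto
  qed
qed

text \<open>Ping-pong with \<open>U\<close> the complement of the finite set of points
  \<open>act t y\<close>; its \<open>h\<close> serves as \<open>x\<close>. The image of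
  \<open>y\<close> under \<open>g + (s + h + t)\<close> determines \<open>s\<close>, and
  cancellation then gives \<open>t\<close>.\<close>

lemma generic_element:
  assumes "finite (T :: 'g set)"
  obtains x where "\<And>s t s' t'. s \<in> T \<Longrightarrow> t \<in> T \<Longrightarrow> s' \<in> T \<Longrightarrow> t' \<in> T \<Longrightarrow>
    s + x + t = s' + x + t' \<Longrightarrow> s = s' \<and> t = t'"
proof (cases "T = {}")
  case True
  then show ?thesis using that by blast
next
  case False
  fix y :: 'x
  let ?U = "- (\<lambda>t. act t y) ` T"
  have fin: "finite ((\<lambda>t. act t y) ` T)" using assms by simp
  \<comment> \<open>Finite Hausdorff spaces have open singletons.\<close>
  have "infinite (UNIV :: 'x set)"
    using not_open_singleton[of y] finite_imp_closed[of "- {y}"] rev_finite_subset[of UNIV "- {y}"]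
    by (auto simp: closed_def)
  then have "(\<lambda>t. act t y) ` T \<noteq> UNIV" using fin by metis
  then have U: "open ?U" "?U \<noteq> {}"
    using finite_imp_closed[OF fin] by (auto simp: closed_def)
  obtain g h where "\<And>t x. t \<in> T \<Longrightarrow> x \<notin> ?U \<Longrightarrow> act (g + t + h) x \<in> ?U"
    and gh: "\<And>t t' x y. t \<in> T \<Longrightarrow> t' \<in> T \<Longrightarrow> x \<notin> ?U \<Longrightarrow> y \<notin> ?U \<Longrightarrow>
      act (g + t + h) x = act (g + t' + h) y \<Longrightarrow> t = t'"
    by (rule ping_pong_translates[OF assms False U U]) (rule that)
  show ?thesis
  proof (rule that)
    fix s t s' t' assume T: "s \<in> T" "t \<in> T" "s' \<in> T" "t' \<in> T" and eq: "s + h + t = s' + h + t'"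
    have "act (g + s + h) (act t y) = act (g + (s + h + t)) y" by simp
    also have "\<dots> = act (g + s' + h) (act t' y)" by (simp only: eq) simp
    finally have "s = s'" using gh[OF T(1,3)] T by blast
    then show "s = s' \<and> t = t'" using eq by (simp add: add.assoc)
  qed
qed

end


section \<open>Finitely supported functions\<close>

lemma lookup_times:
  "Poly_Mapping.lookup (f * g) k =
    (\<Sum>a\<in>Poly_Mapping.keys f. \<Sum>b\<in>Poly_Mapping.keys g.
      if a + b = k then Poly_Mapping.lookup f a * Poly_Mapping.lookup g b else 0)"
  for f g :: "'g::monoid_add \<Rightarrow>\<^sub>0 'r::semiring_0"
proof -
  have inner: "(\<Sum>q. Poly_Mapping.lookup g q when k = a + q) =
    (\<Sum>q\<in>Poly_Mapping.keys g. Poly_Mapping.lookup g q when k = a + q)" for a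
    by (rule Sum_any.expand_superset) (auto simp: in_keys_iff when_def)
  have "Poly_Mapping.lookup (f * g) k =
    (\<Sum>a\<in>Poly_Mapping.keys f. Poly_Mapping.lookup f a *
      (\<Sum>q. Poly_Mapping.lookup g q when k = a + q))"
    unfolding lookup_mult by (rule Sum_any.expand_superset) (auto simp: in_keys_iff)
  then show ?thesis
    unfolding inner by (auto simp: sum_distrib_left when_def intro!: sum.cong)
qed

lemma lookup_times_unique:
  fixes f g :: "'g::monoid_add \<Rightarrow>\<^sub>0 'r::semiring_0"
  assumes "\<And>a b. a \<in> Poly_Mapping.keys f \<Longrightarrow> b \<in> Poly_Mapping.keys g \<Longrightarrow> a + b = s + t \<Longrightarrow> a = s \<and> b = t"
  shows "Poly_Mapping.lookup (f * g) (s + t) = Poly_Mapping.lookup f s * Poly_Mapping.lookup g t"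
proof -
  have "Poly_Mapping.lookup (f * g) (s + t) =
    (\<Sum>a\<in>Poly_Mapping.keys f. \<Sum>b\<in>Poly_Mapping.keys g.
      if b = t then if a = s then Poly_Mapping.lookup f a * Poly_Mapping.lookup g b else 0 else 0)"
    unfolding lookup_times by (intro sum.cong refl) (use assms in auto)
  also have "\<dots> = Poly_Mapping.lookup f s * Poly_Mapping.lookup g t"
    by (cases "s \<in> Poly_Mapping.keys f"; cases "t \<in> Poly_Mapping.keys g")
       (simp_all add: in_keys_iff)
  finally show ?thesis .
qed

lemma lookup_single_times:
  fixes f :: "'g::group_add \<Rightarrow>\<^sub>0 'r::semiring_0"
  shows "Poly_Mapping.lookup (Poly_Mapping.single g c * f) (g + k) = c * Poly_Mapping.lookup f k"
  by (subst lookup_times_unique) (auto split: if_splits)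

lemma lookup_times_single:
  fixes f :: "'g::group_add \<Rightarrow>\<^sub>0 'r::semiring_0"
  shows "Poly_Mapping.lookup (f * Poly_Mapping.single g c) (k + g) = Poly_Mapping.lookup f k * c"
  by (subst lookup_times_unique) (auto split: if_splits)

lemma keys_add_disjoint:
  fixes f g :: "'a \<Rightarrow>\<^sub>0 'b::monoid_add"
  assumes "Poly_Mapping.keys f \<inter> Poly_Mapping.keys g = {}"
  shows "Poly_Mapping.keys (f + g) = Poly_Mapping.keys f \<union> Poly_Mapping.keys g"
proof -
  have "Poly_Mapping.lookup f k = 0 \<or> Poly_Mapping.lookup g k = 0" for k
    using assms by (auto simp: in_keys_iff)
  then show ?thesis
    unfolding set_eq_iff Un_iff in_keys_iff lookup_add by (metis add.left_neutral add.right_neutral)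
qed

lemma keys_translate:
  fixes f :: "'g::group_add \<Rightarrow>\<^sub>0 'r::ring_1"
  shows "Poly_Mapping.keys (Poly_Mapping.single g 1 * f * Poly_Mapping.single h 1)
    = (\<lambda>t. g + t + h) ` Poly_Mapping.keys f" (is "Poly_Mapping.keys ?f = _")
proof -
  have lookup: "Poly_Mapping.lookup ?f (g + t + h) = Poly_Mapping.lookup f t" for t
    by (simp add: lookup_times_single lookup_single_times)
  have "k \<in> Poly_Mapping.keys ?f \<longleftrightarrow> - g + (k - h) \<in> Poly_Mapping.keys f" for k
    using lookup[of "- g + (k - h)"] by (simp add: in_keys_iff add.assoc [symmetric])
  then show ?thesis
    by (force simp: add.assoc [symmetric] image_iff intro!: bexI[of _ "- g + (_ - h)"])
qed

lemma sum_single_lookup: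
  "(\<Sum>k\<in>Poly_Mapping.keys f. Poly_Mapping.single k (Poly_Mapping.lookup f k)) = f"
  by (rule poly_mapping_eqI)
     (auto simp: lookup_sum lookup_single when_def in_keys_iff)

text \<open>Lists serve twice: over a countable set there are only countably many, and their length
  supports induction.\<close>

lemma poly_mapping_as_list_sum:
  fixes f :: "'a \<Rightarrow>\<^sub>0 'b::comm_monoid_add"
  shows "\<exists>xs. (\<Sum>k\<leftarrow>xs. Poly_Mapping.single k (Poly_Mapping.lookup f k)) = f"
proof -
  obtain xs where "set xs = Poly_Mapping.keys f" "distinct xs"
    using finite_distinct_list[OF finite_keys, of f] by blast
  then show ?thesis
    by (intro exI[of _ xs]) (simp add: sum_list_distinct_conv_sum_set sum_single_lookup)
qed

lemma countable_poly_mapping: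
  assumes "countable (UNIV :: 'g set)" "countable Z"
  shows "countable {f :: 'g \<Rightarrow>\<^sub>0 'r::comm_monoid_add. \<forall>k. Poly_Mapping.lookup f k \<in> Z}"
proof (rule countable_subset)
  let ?s = "\<lambda>xs :: ('g \<times> 'r) list. \<Sum>(k, c)\<leftarrow>xs. Poly_Mapping.single k c"
  show "countable (?s ` lists (UNIV \<times> Z))"
    using assms by (intro countable_image countable_lists countable_SIGMA)
  show "{f. \<forall>k. Poly_Mapping.lookup f k \<in> Z} \<subseteq> ?s ` lists (UNIV \<times> Z)"
  proof
    fix f :: "'g \<Rightarrow>\<^sub>0 'r" assume f: "f \<in> {f. \<forall>k. Poly_Mapping.lookup f k \<in> Z}"
    obtain xs where "(\<Sum>k\<leftarrow>xs. Poly_Mapping.single k (Poly_Mapping.lookup f k)) = f"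
      using poly_mapping_as_list_sum by blast
    then show "f \<in> ?s ` lists (UNIV \<times> Z)"
      using f by (intro image_eqI[of _ _ "map (\<lambda>k. (k, Poly_Mapping.lookup f k)) xs"])
        (auto simp: o_def)
  qed
qed


section \<open>Primitivity of the group ring\<close>

context free_extremely_proximal_action
begin

text \<open>
  A summand \<open>e\<close> of \<open>b n\<close> multiplied with a group element \<open>q\<close> in the support of \<open>r n\<close> is tagged with the
  set \<open>q\<inverse> (C n e)\<close>.  If two such products coincide, the tags cover the whole space, so that products
  with a minimal tag cannot cancel.  Minimal tags exist below disjoint ones, whence the support of the
  sum has at least two elements.
\<close>

lemma sum_mult_neq_one:
  fixes b r :: "nat \<Rightarrow> 'g \<Rightarrow>\<^sub>0 'r::ring_1_no_zero_divisors" and C :: "nat \<Rightarrow> 'g \<Rightarrow> 'x set"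
  assumes disj: "\<And>m n e f x y. e \<in> Poly_Mapping.keys (b m) \<Longrightarrow> f \<in> Poly_Mapping.keys (b n) \<Longrightarrow>
      x \<notin> C m e \<Longrightarrow> y \<notin> C n f \<Longrightarrow> act e x = act f y \<Longrightarrow> m = n \<and> e = f"
    and nonempty: "\<And>n e. e \<in> Poly_Mapping.keys (b n) \<Longrightarrow> C n e \<noteq> {}"
    and nonzero: "\<And>n. b n \<noteq> 0"
    and smaller: "\<And>n e. e \<in> Poly_Mapping.keys (b n) \<Longrightarrow>
      \<exists>f\<in>Poly_Mapping.keys (b n). C n f \<subset> - C n e"
  shows "(\<Sum>n<N. b n * r n) \<noteq> 1"
proof
  assume one: "(\<Sum>n<N. b n * r n) = 1"
  \<comment> \<open>One triple for each elementary product in the expanded sum; \<open>pr\<close> is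
    its group element and \<open>c\<close> its coefficient.\<close>
  define \<Omega> where "\<Omega> = (SIGMA n:{..<N}. Poly_Mapping.keys (b n) \<times> Poly_Mapping.keys (r n))"
  define tag where "tag = (\<lambda>(n, e, q). act q -` C n e)"
  define pr :: "nat \<times> 'g \<times> 'g \<Rightarrow> 'g" where "pr = (\<lambda>(n, e, q). e + q)"
  define c where "c = (\<lambda>(n, e, q). Poly_Mapping.lookup (b n) e * Poly_Mapping.lookup (r n) q)"
  have fin: "finite \<Omega>" by (simp add: \<Omega>_def)
  have coeff: "Poly_Mapping.lookup (\<Sum>n<N. b n * r n) k = (\<Sum>\<omega>\<in>\<Omega>. if pr \<omega> = k then c \<omega> else 0)" for k
    unfolding \<Omega>_def lookup_sum lookup_times
    by (simp add: sum.cartesian_product sum.Sigma pr_def c_def case_prod_unfold cong: if_cong)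
  \<comment> \<open>At a point outside both tags, \<open>disj\<close> identifies the two summands;
    equal products then force equal \<open>q\<close>.\<close>
  have collide: "- tag \<omega> \<subseteq> tag \<omega>'" if "\<omega> \<in> \<Omega>" "\<omega>' \<in> \<Omega>" "\<omega> \<noteq> \<omega>'" "pr \<omega> = pr \<omega>'" for \<omega> \<omega>'
  proof
    fix x assume x: "x \<in> - tag \<omega>"
    obtain n e q n' q' e' where \<omega>: "\<omega> = (n, e, q)" "\<omega>' = (n', e', q')"
      by (metis prod_cases3)
    have eq: "e + q = e' + q'" using that \<omega> by (simp add: pr_def)
    then have "act e (act q x) = act e' (act q' x)" by (metis act_add)
    then have "n = n' \<and> e = e'" if "x \<notin> tag \<omega>'"
      using that \<open>\<omega> \<in> \<Omega>\<close> \<open>\<omega>' \<in> \<Omega>\<close> x \<omega> disj[of e n e' n' "act q x" "act q' x"]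
      by (auto simp: tag_def \<Omega>_def)
    then show "x \<in> tag \<omega>'" using \<open>\<omega> \<noteq> \<omega>'\<close> \<omega> eq by (metis add_left_cancel)
  qed
  have vimage_mono: "act q -` P \<subseteq> act q -` Q \<longleftrightarrow> P \<subseteq> Q" for q P Q
    by (metis act_minus_act(2) subset_iff vimage_eq)
  have below: "\<exists>\<omega>'\<in>\<Omega>. tag \<omega>' \<subseteq> tag \<omega> \<and> pr \<omega>' = 0 \<and> (\<forall>\<omega>''\<in>\<Omega>. pr \<omega>'' = 0 \<longrightarrow> \<omega>'' = \<omega>')"
    if \<omega>: "\<omega> \<in> \<Omega>" for \<omega>
  proof -
    obtain T where "T \<in> tag ` \<Omega>" "T \<subseteq> tag \<omega>" and T: "\<forall>S\<in>tag ` \<Omega>. S \<subseteq> T \<longrightarrow> T = S"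
      using finite_has_minimal2[of "tag ` \<Omega>" "tag \<omega>"] fin \<omega> by blast
    then obtain \<omega>' where \<omega>': "\<omega>' \<in> \<Omega>" "T = tag \<omega>'" by blast
    \<comment> \<open>If a second triple had the same product, \<open>smaller\<close> would give a
      tag strictly inside the complement of its tag, hence strictly below the minimal one.\<close>
    have alone: "\<omega>'' = \<omega>'" if \<omega>'': "\<omega>'' \<in> \<Omega>" "pr \<omega>'' = pr \<omega>'" for \<omega>''
    proof (rule ccontr)
      assume ne: "\<omega>'' \<noteq> \<omega>'"
      obtain n e q where nqe: "\<omega>'' = (n, e, q)" by (rule prod_cases3)
      then obtain f where f: "f \<in> Poly_Mapping.keys (b n)" "C n f \<subset> - C n e"
        using smaller[of e n] \<omega>'' by (auto simp: \<Omega>_def)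
      then have "tag (n, f, q) \<subset> tag \<omega>'"
        using vimage_mono[of q "C n f" "- C n e"] vimage_mono[of q "- C n e" "C n f"]
          collide[OF \<omega>''(1) \<omega>'(1) ne \<omega>''(2)] nqe by (auto simp: tag_def vimage_Compl)
      moreover have "(n, f, q) \<in> \<Omega>" using \<omega>'' nqe f by (simp add: \<Omega>_def)
      ultimately show False using T \<omega>' by blast
    qed
    have "Poly_Mapping.lookup (\<Sum>n<N. b n * r n) (pr \<omega>') = (\<Sum>\<omega>\<in>\<Omega>. if \<omega> = \<omega>' then c \<omega>' else 0)"
      unfolding coeff using alone \<omega>' by (intro sum.cong) auto
    also have "\<dots> = c \<omega>'" using fin \<omega>' by simp
    \<comment> \<open>Absence of zero divisors enters here. The only nonzero coefficient of
      \<open>1\<close> is at \<open>0\<close>, which locates \<open>pr \<omega>'\<close>.\<close>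
    also have "\<dots> \<noteq> 0" using \<omega>' by (auto simp: c_def \<Omega>_def in_keys_iff)
    finally have "pr \<omega>' = 0" by (simp add: one lookup_one when_def split: if_splits)
    then have "\<omega>'' = \<omega>'" if "\<omega>'' \<in> \<Omega>" "pr \<omega>'' = 0" for \<omega>''
      using alone[OF that(1)] that(2) by simp
    then show ?thesis using \<omega>' \<open>T \<subseteq> tag \<omega>\<close> \<open>pr \<omega>' = 0\<close> by blast
  qed
  have "\<Omega> \<noteq> {}"
    using coeff[of 0] one by (auto simp: lookup_one)
  then obtain n e q where nqe: "(n, e, q) \<in> \<Omega>" by auto
  then obtain f where f: "f \<in> Poly_Mapping.keys (b n)" "C n f \<subset> - C n e"
    using smaller[of e n] by (auto simp: \<Omega>_def)
  then have "(n, f, q) \<in> \<Omega>" using nqe by (simp add: \<Omega>_def)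
  \<comment> \<open>The isolated triples below two disjoint tags both have product \<open>0\<close>,
    so they are one triple, whose tag must then be empty.\<close>
  then obtain \<omega> where \<omega>: "\<omega> \<in> \<Omega>" "tag \<omega> \<subseteq> tag (n, e, q)" "tag \<omega> \<subseteq> tag (n, f, q)"
    using below[OF nqe] below[of "(n, f, q)"] by blast
  have "tag (n, e, q) \<inter> tag (n, f, q) = {}" using f by (auto simp: tag_def)
  then have "tag \<omega> = {}" using \<omega> by blast
  moreover have "tag \<omega> \<noteq> {}"
    using \<omega>(1) nonempty vimage_mono[of _ _ "{}"] by (cases \<omega>) (auto simp: \<Omega>_def tag_def)
  ultimately show False by blast
qed

text \<open>Modulo \<open>J\<close>, a two-sided multiple of each \<open>a\<close> in
  \<open>A\<close> equals minus a unit; every two-sided ideal meeting \<open>A\<close> is therefore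
  comaximal with \<open>J\<close>.\<close>

lemma comaximal_right_ideal:
  fixes A :: "('g \<Rightarrow>\<^sub>0 'r::ring_1_no_zero_divisors) set"
  assumes A: "countable A" "0 \<notin> A"
  obtains J where "is_right_ideal J" "1 \<notin> J" "\<And>a. a \<in> A \<Longrightarrow>
    \<exists>u g h. Poly_Mapping.single u 1 + Poly_Mapping.single g 1 * a * Poly_Mapping.single h 1 \<in> J"
proof -
  \<comment> \<open>Inserting the nonzero element \<open>1\<close> makes the enumerated set
    nonempty, also for empty \<open>A\<close>.\<close>
  define a where "a = from_nat_into (insert 1 A)"
  have range_a: "range a = insert 1 A"
    using A unfolding a_def by (intro range_from_nat_into) auto
  have "a n \<in> insert 1 A" for n
    using range_a by blast
  then have a_nonzero: "a n \<noteq> 0" for n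
    using A(2) by (metis insert_iff zero_neq_one)
  obtain D :: "nat \<Rightarrow> 'x set" where D: "\<And>n. open (D n)" "\<And>n. D n \<noteq> {}"
    and D_disj: "\<And>m n. m \<noteq> n \<Longrightarrow> D m \<inter> D n = {}"
    by (rule disjoint_open_family) (rule that)
  have D_eq: "m = n" if "x \<in> D m" "x \<in> D n" for m n x
    using that D_disj[of m n] by blast
  \<comment> \<open>Four sets are reserved for each \<open>n\<close>: \<open>u n\<close> contracts
    the complement of the first into the second, the translated support of \<open>a n\<close> that
    of the third into the fourth.\<close>
  have "\<forall>n. \<exists>u. \<forall>x. x \<notin> D (4 * n) \<longrightarrow> act u x \<in> D (4 * n + 1)"
    using proximalE D by metis
  then obtain u where u: "\<And>n x. x \<notin> D (4 * n) \<Longrightarrow> act (u n) x \<in> D (4 * n + 1)"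
    by metis
  have "\<exists>g h. (\<forall>t x. t \<in> Poly_Mapping.keys (a n) \<longrightarrow> x \<notin> D (4 * n + 2) \<longrightarrow>
        act (g + t + h) x \<in> D (4 * n + 3)) \<and>
      (\<forall>t t' x y. t \<in> Poly_Mapping.keys (a n) \<longrightarrow> t' \<in> Poly_Mapping.keys (a n) \<longrightarrow>
        x \<notin> D (4 * n + 2) \<longrightarrow> y \<notin> D (4 * n + 2) \<longrightarrow>
        act (g + t + h) x = act (g + t' + h) y \<longrightarrow> t = t')" for n
  proof -
    have "Poly_Mapping.keys (a n) \<noteq> {}" using a_nonzero[of n] by simp
    from ping_pong_translates[OF finite_keys this D(1,2) D(1,2), of "4 * n + 2" "4 * n + 3"]
    show ?thesis by metis
  qed
  then obtain g h where gh: "\<And>n t x. t \<in> Poly_Mapping.keys (a n) \<Longrightarrow> x \<notin> D (4 * n + 2) \<Longrightarrow>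
        act (g n + t + h n) x \<in> D (4 * n + 3)"
    and gh_inj: "\<And>n t t' x y. t \<in> Poly_Mapping.keys (a n) \<Longrightarrow> t' \<in> Poly_Mapping.keys (a n) \<Longrightarrow>
        x \<notin> D (4 * n + 2) \<Longrightarrow> y \<notin> D (4 * n + 2) \<Longrightarrow>
        act (g n + t + h n) x = act (g n + t' + h n) y \<Longrightarrow> t = t'"
    by metis
  define b where
    "b n = Poly_Mapping.single (u n) 1 + Poly_Mapping.single (g n) 1 * a n * Poly_Mapping.single (h n) 1" for n
  define C where "C n e = (if e = u n then D (4 * n) else D (4 * n + 2))" for n e
  let ?E = "\<lambda>n. (\<lambda>t. g n + t + h n) ` Poly_Mapping.keys (a n)"
  \<comment> \<open>A point of \<open>D (4 * n + 1)\<close> lies outside both excluded sets; a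
    common element would send it into two disjoint targets. Hence no term cancels in
    \<open>b n\<close>.\<close>
  have u_notin: "u n \<notin> ?E n" for n
  proof
    assume "u n \<in> ?E n"
    then obtain t where t: "t \<in> Poly_Mapping.keys (a n)" "u n = g n + t + h n" by blast
    obtain x where "x \<in> D (4 * n + 1)" using D(2) by blast
    then have x: "x \<notin> D (4 * n)" "x \<notin> D (4 * n + 2)"
      using D_eq[of x "4 * n + 1" "4 * n"] D_eq[of x "4 * n + 1" "4 * n + 2"] by auto
    show False
      using D_eq[OF u[OF x(1)], of "4 * n + 3"] gh[OF t(1) x(2)] t(2) by simp
  qed
  have keys_b: "Poly_Mapping.keys (b n) = insert (u n) (?E n)" for n
    unfolding b_def using u_notin[of n] by (subst keys_add_disjoint) (simp_all add: keys_translate)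
  have into: "act e x \<in> D (if e = u n then 4 * n + 1 else 4 * n + 3)"
    if "e \<in> Poly_Mapping.keys (b n)" "x \<notin> C n e" for n e x
    using that u gh u_notin by (auto simp: keys_b C_def)
  have one_notin: "(\<Sum>n<N. b n * r n) \<noteq> 1" for N r
  proof (rule sum_mult_neq_one)
    fix m n e f x y
    assume e: "e \<in> Poly_Mapping.keys (b m)" "x \<notin> C m e" and f: "f \<in> Poly_Mapping.keys (b n)" "y \<notin> C n f"
      and eq: "act e x = act f y"
    \<comment> \<open>The index of the target set reveals \<open>n\<close> and whether the element
      is \<open>u n\<close>; among the translates, \<open>gh_inj\<close> decides.\<close>
    have "(if e = u m then 4 * m + 1 else 4 * m + 3) = (if f = u n then 4 * n + 1 else 4 * n + 3)"
      using D_eq[OF into[OF e]] into[OF f] eq by simp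
    then have mn: "m = n" and u_iff: "e = u m \<longleftrightarrow> f = u n"
      by (auto split: if_splits) presburger+
    have "e = f" if "e \<noteq> u m"
    proof -
      obtain t t' where t: "t \<in> Poly_Mapping.keys (a n)" "e = g n + t + h n"
        "t' \<in> Poly_Mapping.keys (a n)" "f = g n + t' + h n"
        using e f \<open>e \<noteq> u m\<close> u_iff mn by (auto simp: keys_b)
      moreover have "x \<notin> D (4 * n + 2)" "y \<notin> D (4 * n + 2)"
        using e f \<open>e \<noteq> u m\<close> u_iff mn by (auto simp: C_def)
      ultimately show ?thesis using gh_inj[of t n t' x y] eq by simp
    qed
    then show "m = n \<and> e = f" using mn u_iff by metis
  next
    show "C n e \<noteq> {}" for n e using D by (simp add: C_def)
    show "b n \<noteq> 0" for n using keys_b[of n] by (metis insert_not_empty keys_zero)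
    fix n e assume "e \<in> Poly_Mapping.keys (b n)"
    obtain t where t: "t \<in> Poly_Mapping.keys (a n)"
      using a_nonzero[of n] by (metis all_not_in_conv keys_eq_empty)
    obtain x where x: "x \<in> D (4 * n + 1)" using D by blast
    \<comment> \<open>The point \<open>x\<close> lies in neither set, so the inclusion is strict.
      Below, \<open>u n\<close> is paired with any translate, and each translate with
      \<open>u n\<close>.\<close>
    have sub: "D i \<subset> - D j" if "i \<noteq> j" "i \<noteq> 4 * n + 1" "j \<noteq> 4 * n + 1" for i j
      using that D_disj[of i j] D_eq[OF x, of i] D_eq[OF x, of j] x by blast
    show "\<exists>f\<in>Poly_Mapping.keys (b n). C n f \<subset> - C n e"
    proof (cases "e = u n")
      case True
      have "g n + t + h n \<noteq> u n" using u_notin t by (metis imageI)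
      then show ?thesis
        using t True sub[of "4 * n + 2" "4 * n"] by (intro bexI[of _ "g n + t + h n"]) (auto simp: keys_b C_def)
    next
      case False
      then show ?thesis
        using sub[of "4 * n" "4 * n + 2"] by (intro bexI[of _ "u n"]) (auto simp: keys_b C_def)
    qed
  qed
  define J where "J = {\<Sum>n<N. b n * r n | N r. True}"
  have J_I: "(\<Sum>n<N. b n * r n) \<in> J" for N r by (auto simp: J_def)
  show thesis
  proof
    show "1 \<notin> J" using one_notin by (force simp: J_def)
    have "x + y \<in> J" if xy: "x \<in> J" "y \<in> J" for x y
    proof -
      obtain M r N s where x: "x = (\<Sum>n<M. b n * r n)" and y: "y = (\<Sum>n<N. b n * s n)"
        using xy by (auto simp: J_def)
      \<comment> \<open>Padding with zero coefficients brings two sums to a common length.\<close>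
      have extend: "(\<Sum>n<M. b n * r n) = (\<Sum>n<K. b n * (if n < M then r n else 0))" if "M \<le> K" for M K r
        using that by (intro sum.mono_neutral_cong_left) auto
      have "x + y = (\<Sum>n<max M N. b n * ((if n < M then r n else 0) + (if n < N then s n else 0)))"
        unfolding x y extend[of M "max M N" r, OF max.cobounded1] extend[of N "max M N" s, OF max.cobounded2]
        by (simp only: distrib_left sum.distrib)
      then show ?thesis by (simp only: J_I)
    qed
    moreover have "x * s \<in> J" if x: "x \<in> J" for x s
    proof -
      obtain N r where "x = (\<Sum>n<N. b n * r n)" using x unfolding J_def by blast
      then have "x * s = (\<Sum>n<N. b n * (r n * s))" by (simp add: sum_distrib_right mult.assoc)
      then show ?thesis by (simp only: J_I)
    qed
    moreover have "0 \<in> J" using J_I[where N = 0] by simp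
    ultimately show "is_right_ideal J" by (simp add: is_right_ideal_def)
    fix c assume "c \<in> A"
    then obtain n where "a n = c" using range_a by (metis insertCI rangeE)
    moreover have "b n = (\<Sum>k<Suc n. b k * (if k = n then 1 else 0))" by simp
    then have "b n \<in> J" by (metis J_I)
    ultimately show "\<exists>u g h. Poly_Mapping.single u 1
        + Poly_Mapping.single g 1 * c * Poly_Mapping.single h 1 \<in> J"
      by (auto simp: b_def)
  qed
qed

lemma right_primitive_group_ring:
  fixes A :: "('g \<Rightarrow>\<^sub>0 'r::ring_1_no_zero_divisors) set"
  assumes A: "countable A" "0 \<notin> A"
    and meets: "\<And>I. is_right_ideal I \<Longrightarrow> (\<And>s x. x \<in> I \<Longrightarrow> s * x \<in> I) \<Longrightarrow> I \<noteq> {0} \<Longrightarrow> I \<inter> A \<noteq> {}"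
  shows "right_primitive (group_ring :: ('g \<Rightarrow>\<^sub>0 'r) ring)"
proof -
  obtain J where J: "is_right_ideal J" "1 \<notin> J" and uJ: "\<And>a. a \<in> A \<Longrightarrow>
    \<exists>u g h. Poly_Mapping.single u 1 + Poly_Mapping.single g 1 * a * Poly_Mapping.single h 1 \<in> J"
    by (rule comaximal_right_ideal[OF A]) (rule that)
  show ?thesis
  proof (rule right_primitive_if_comaximal[OF J])
    fix I :: "('g \<Rightarrow>\<^sub>0 'r) set"
    assume I: "is_right_ideal I" "\<And>s x. x \<in> I \<Longrightarrow> s * x \<in> I" "I \<noteq> {0}"
    obtain a where a: "a \<in> I" "a \<in> A" using meets[OF I] by blast
    obtain u g h where ugh: "Poly_Mapping.single u 1 + Poly_Mapping.single g 1 * a * Poly_Mapping.single h 1 \<in> J"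
      using uJ[OF a(2)] by blast
    \<comment> \<open>Dividing the element of \<open>J\<close> by its unit part gives
      \<open>?y = 1 + ?x\<close> with \<open>?x\<close> in \<open>I\<close>.\<close>
    let ?x = "Poly_Mapping.single g 1 * a * Poly_Mapping.single h 1 * Poly_Mapping.single (- u) 1"
    let ?y = "(Poly_Mapping.single u 1 + Poly_Mapping.single g 1 * a * Poly_Mapping.single h 1)
      * Poly_Mapping.single (- u) 1"
    have "?x \<in> I"
      by (rule is_right_idealD(3)[OF I(1) is_right_idealD(3)[OF I(1) I(2)[OF a(1)]]])
    then have "- ?x \<in> I" by (rule is_right_idealD(4)[OF I(1)])
    moreover have "?y \<in> J" using ugh by (rule is_right_idealD(3)[OF J(1)])
    moreover have "- ?x + ?y = 1" by (simp add: distrib_right mult_single)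
    ultimately show "\<exists>x\<in>I. \<exists>y\<in>J. x + y = 1" by blast
  qed
qed

end


section \<open>Ideals and integral elements\<close>

context free_extremely_proximal_action
begin

text \<open>
  Passing from \<open>K\<close> to its countable subring of integers: a nonzero \<open>\<alpha> = \<Sum> c\<^sub>i a\<^sub>i\<close> in the ideal with
  integral \<open>a\<^sub>i\<close> is either a scalar multiple of \<open>a\<^sub>1\<close>, or some \<open>a\<^sub>1 x \<alpha> - \<alpha> x a\<^sub>1\<close> is nonzero, and this
  is a shorter sum.
\<close>

lemma ideal_contains_integral:
  fixes I :: "('g \<Rightarrow>\<^sub>0 'k::field) set"
  assumes I: "is_right_ideal I" "\<And>s x. x \<in> I \<Longrightarrow> s * x \<in> I" "I \<noteq> {0}"
  shows "\<exists>a\<in>I. a \<noteq> 0 \<and> (\<forall>k. Poly_Mapping.lookup a k \<in> \<int>)"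
proof -
  let ?int = "\<lambda>a :: 'g \<Rightarrow>\<^sub>0 'k. \<forall>k. Poly_Mapping.lookup a k \<in> \<int>"
  let ?sum = "\<lambda>xs :: ('k \<times> ('g \<Rightarrow>\<^sub>0 'k)) list. \<Sum>(c, a)\<leftarrow>xs. Poly_Mapping.single 0 c * a"
  have lookup_scale: "Poly_Mapping.lookup (Poly_Mapping.single 0 c * f) k = c * Poly_Mapping.lookup f k"
    for c and f :: "'g \<Rightarrow>\<^sub>0 'k" and k
    using lookup_single_times[of 0 c f k] by simp
  have central: "f * Poly_Mapping.single 0 c = Poly_Mapping.single 0 c * f" for c and f :: "'g \<Rightarrow>\<^sub>0 'k"
    by (rule poly_mapping_eqI) (use lookup_times_single[of f 0 c] in \<open>simp add: lookup_scale mult.commute\<close>)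
  have int_times: "?int (f * g)" if "?int f" "?int g" for f g
    using that by (auto simp: lookup_times intro!: Ints_sum Ints_mult)
  have int_single: "?int (Poly_Mapping.single k 1)" for k
    by (simp add: lookup_single when_def)
  have main: "\<exists>a\<in>I. a \<noteq> 0 \<and> ?int a"
    if "\<forall>(c, a)\<in>set xs. ?int a" "?sum xs \<in> I" "?sum xs \<noteq> 0" for xs
    using that
  proof (induction "length xs" arbitrary: xs)
    case 0
    then show ?case by simp
  next
    case (Suc n)
    then obtain c a ys where xs: "xs = (c, a) # ys" by (cases xs) auto
    have a: "?int a" and ys: "\<forall>(c, a)\<in>set ys. ?int a" using Suc.prems(1) by (auto simp: xs)
    define \<alpha> where "\<alpha> = ?sum xs"
    have \<alpha>: "\<alpha> = Poly_Mapping.single 0 c * a + ?sum ys" "\<alpha> \<in> I" "\<alpha> \<noteq> 0"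
      using Suc.prems by (simp_all add: \<alpha>_def xs)
    consider "a = 0" | x where "a \<noteq> 0" "a * Poly_Mapping.single x 1 * \<alpha> \<noteq> \<alpha> * Poly_Mapping.single x 1 * a"
      | "a \<noteq> 0" "\<And>x. a * Poly_Mapping.single x 1 * \<alpha> = \<alpha> * Poly_Mapping.single x 1 * a" by blast
    then show ?case
    proof cases
      case 1
      then show ?thesis using Suc.hyps(1)[of ys] Suc.hyps(2) ys \<alpha> by (simp add: xs)
    next
      case 2
      \<comment> \<open>\<open>\<phi>\<close> commutes with scalars, preserves integrality and the
        ideal, and kills \<open>a\<close>; the first summand of \<open>\<alpha>\<close>
        disappears.\<close>
      define \<phi> where "\<phi> f = a * Poly_Mapping.single x 1 * f - f * Poly_Mapping.single x 1 * a" for f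
      let ?zs = "map (\<lambda>(c, b). (c, \<phi> b)) ys"
      have \<phi>_add: "\<phi> (f + g) = \<phi> f + \<phi> g" for f g by (simp add: \<phi>_def algebra_simps)
      have \<phi>_scale: "\<phi> (Poly_Mapping.single 0 c * f) = Poly_Mapping.single 0 c * \<phi> f" for c f
      proof -
        have "a * Poly_Mapping.single x 1 * (Poly_Mapping.single 0 c * f)
          = Poly_Mapping.single 0 c * (a * Poly_Mapping.single x 1 * f)"
          by (metis central mult.assoc)
        then show ?thesis by (simp add: \<phi>_def right_diff_distrib mult.assoc)
      qed
      have "\<phi> a = 0" "\<phi> 0 = 0" by (simp_all add: \<phi>_def)
      then have "\<phi> \<alpha> = \<phi> (?sum ys)" by (simp add: \<alpha>(1) \<phi>_add \<phi>_scale)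
      also have "\<dots> = ?sum ?zs"
        by (induction ys) (auto simp: \<phi>_add \<phi>_scale \<open>\<phi> 0 = 0\<close>)
      finally have "\<phi> \<alpha> = ?sum ?zs" .
      moreover have "\<phi> \<alpha> \<in> I"
        unfolding \<phi>_def using is_right_idealD[OF I(1)] I(2) \<alpha>(2) by metis
      moreover have "\<phi> \<alpha> \<noteq> 0" using 2 by (simp add: \<phi>_def)
      moreover have "?int (\<phi> b)" if "?int b" for b
        unfolding \<phi>_def lookup_minus
        by (intro allI Ints_diff; rule int_times[OF int_times, THEN spec]; rule a that int_single)
      then have "\<forall>(c, b)\<in>set ?zs. ?int b" using ys by auto
      ultimately show ?thesis using Suc.hyps(1)[of ?zs] Suc.hyps(2) by (simp add: xs)
    next
      case 3
      let ?T = "Poly_Mapping.keys a \<union> Poly_Mapping.keys \<alpha>"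
      \<comment> \<open>For generic \<open>x\<close> no two products \<open>s + x + t\<close>
        coincide, so the commutation relation can be compared coefficient by coefficient.\<close>
      obtain x where x: "\<And>s t s' t'. s \<in> ?T \<Longrightarrow> t \<in> ?T \<Longrightarrow> s' \<in> ?T \<Longrightarrow> t' \<in> ?T \<Longrightarrow>
          s + x + t = s' + x + t' \<Longrightarrow> s = s' \<and> t = t'"
        using generic_element[of ?T] by auto
      have lookup: "Poly_Mapping.lookup (f * Poly_Mapping.single x 1 * g) (s + x + t)
          = Poly_Mapping.lookup f s * Poly_Mapping.lookup g t"
        if fg: "Poly_Mapping.keys f \<subseteq> ?T" "Poly_Mapping.keys g \<subseteq> ?T" and st: "s \<in> ?T" "t \<in> ?T"
        for f g :: "'g \<Rightarrow>\<^sub>0 'k" and s t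
      proof -
        have keys: "Poly_Mapping.keys (f * Poly_Mapping.single x 1) = (\<lambda>s. s + x) ` Poly_Mapping.keys f"
          using keys_translate[of 0 f x] by simp
        have "p = s + x \<and> q = t" if p: "p \<in> Poly_Mapping.keys (f * Poly_Mapping.single x 1)"
          and q: "q \<in> Poly_Mapping.keys g" and eq: "p + q = s + x + t" for p q
        proof -
          obtain s' where s': "s' \<in> Poly_Mapping.keys f" "p = s' + x" using p keys by blast
          have "s' \<in> ?T" "q \<in> ?T" using s'(1) q fg by blast+
          then have "s' = s \<and> q = t" using x[of s' q s t] st eq s'(2) by simp
          then show ?thesis using s'(2) by simp
        qed
        then have "Poly_Mapping.lookup (f * Poly_Mapping.single x 1 * g) ((s + x) + t)
            = Poly_Mapping.lookup (f * Poly_Mapping.single x 1) (s + x) * Poly_Mapping.lookup g t"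
          by (rule lookup_times_unique)
        then show ?thesis by (simp add: lookup_times_single)
      qed
      obtain t where t: "t \<in> Poly_Mapping.keys a" using 3 by (metis all_not_in_conv keys_eq_empty)
      \<comment> \<open>The comparison makes the coefficients of \<open>\<alpha>\<close> and
        \<open>a\<close> proportional; the ratio is read off at a key of \<open>a\<close>.\<close>
      define d where "d = Poly_Mapping.lookup \<alpha> t / Poly_Mapping.lookup a t"
      have "Poly_Mapping.lookup \<alpha> s = d * Poly_Mapping.lookup a s" for s
      proof (cases "s \<in> ?T")
        case True
        have "Poly_Mapping.lookup a s * Poly_Mapping.lookup \<alpha> t
            = Poly_Mapping.lookup \<alpha> s * Poly_Mapping.lookup a t"
          using lookup[of a \<alpha> s t] lookup[of \<alpha> a s t] 3(2)[of x] True t by simp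
        then show ?thesis using t by (simp add: d_def in_keys_iff field_simps)
      qed (simp add: in_keys_iff)
      then have eq: "\<alpha> = Poly_Mapping.single 0 d * a"
        by (intro poly_mapping_eqI) (simp add: lookup_scale)
      then have "d \<noteq> 0" using \<alpha>(3) by auto
      then have "a = Poly_Mapping.single 0 (1 / d) * \<alpha>"
        by (intro poly_mapping_eqI) (simp add: eq lookup_scale)
      then have "a \<in> I" using I(2)[OF \<alpha>(2)] by metis
      then show ?thesis using 3 a by blast
    qed
  qed
  obtain \<alpha> where \<alpha>: "\<alpha> \<in> I" "\<alpha> \<noteq> 0" using I(3) is_right_idealD(1)[OF I(1)] by blast
  obtain ks where "(\<Sum>k\<leftarrow>ks. Poly_Mapping.single k (Poly_Mapping.lookup \<alpha> k)) = \<alpha>"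
    using poly_mapping_as_list_sum by blast
  \<comment> \<open>The group elements themselves are integral, so any element of the ideal starts
    the induction.\<close>
  then have "?sum (map (\<lambda>k. (Poly_Mapping.lookup \<alpha> k, Poly_Mapping.single k 1)) ks) = \<alpha>"
    by (simp add: o_def mult_single)
  then show ?thesis
    using main[of "map (\<lambda>k. (Poly_Mapping.lookup \<alpha> k, Poly_Mapping.single k 1)) ks"] \<alpha> int_single by auto
qed

end

theorem theorem1p4:
  fixes act :: "'g::group_add \<Rightarrow> 'x::t2_space \<Rightarrow> 'x"
  assumes "countable (UNIV :: 'g set)"
    and "\<exists>x y z :: 'x. x \<noteq> y \<and> y \<noteq> z \<and> x \<noteq> z"
    and "homeo_action act"
    and "topologically_free act"
    and "extremely_proximal act"
  shows "(countable (UNIV :: 'r set) \<longrightarrow>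
            right_primitive (group_ring :: ('g \<Rightarrow>\<^sub>0 'r::ring_1_no_zero_divisors) ring)) \<and>
         right_primitive (group_ring :: ('g \<Rightarrow>\<^sub>0 'k::field) ring)"
proof (intro conjI impI)
  interpret free_extremely_proximal_action act
    using assms(2-5) by (rule free_extremely_proximal_action.intro)
  show "right_primitive (group_ring :: ('g \<Rightarrow>\<^sub>0 'r) ring)" if r: "countable (UNIV :: 'r set)"
  proof (rule right_primitive_group_ring[of "- {0}"])
    have "countable (UNIV :: ('g \<Rightarrow>\<^sub>0 'r) set)"
      using countable_poly_mapping[OF assms(1) r] by simp
    then show "countable (- {0 :: 'g \<Rightarrow>\<^sub>0 'r})" by (rule countable_subset[rotated]) simp
    show "I \<inter> - {0} \<noteq> {}" if "is_right_ideal I" "I \<noteq> {0}" for I :: "('g \<Rightarrow>\<^sub>0 'r) set"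
      using is_right_idealD(1)[OF that(1)] that(2) by blast
  qed simp
  \<comment> \<open>The image of the integers in the field is countable whatever the size and
    characteristic of the field.\<close>
  let ?A = "{a :: 'g \<Rightarrow>\<^sub>0 'k. \<forall>k. Poly_Mapping.lookup a k \<in> \<int>} - {0}"
  show "right_primitive (group_ring :: ('g \<Rightarrow>\<^sub>0 'k) ring)"
  proof (rule right_primitive_group_ring[of ?A])
    have "countable (\<int> :: 'k set)" by (simp add: Ints_def)
    then show "countable ?A"
      by (intro countable_Diff countable_poly_mapping assms(1))
    show "I \<inter> ?A \<noteq> {}" if "is_right_ideal I" "\<And>s x. x \<in> I \<Longrightarrow> s * x \<in> I" "I \<noteq> {0}"
      for I :: "('g \<Rightarrow>\<^sub>0 'k) set"
      using ideal_contains_integral[OF that] by blast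
  qed simp
qed

end
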